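(* Let $m\ge 2$ be an integer. For every $x\in(0,1)$ the set $\Lambda(x)$ contains arbitrarily long arithmetic progressions.
   Context: For $\lambda\in(0,1/m]$, $K_\lambda=\left\{\sum_{i=1}^\infty d_i\lambda^i: d_i\in\{0,1,\ldots,m-1\},\ i\ge 1\right\}\subset\mathbb R$, and for $x\in(0,1)$, $\Lambda(x)=\{\lambda\in(0,1/m]: x\in K_\lambda\}$. A set $E\subset\mathbb R$ contains arbitrarily long arithmetic progressions if for every $n\in\mathbb N$ there exist $a,b\in\mathbb R$ with $b\neq 0$ such that $\{a+b,a+2b,\ldots,a+nb\}\subset E$. *)

theory Defs
  imports "HOL-Analysis.Analysis"
begin

(* The paper's index i >= 1 is Suc i here, so d 0 plays no role. The definition is meant for
   0 < l <= 1/m with m >= 2, where every such series converges; elsewhere suminf may be junk. *)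
definition K :: "nat \<Rightarrow> real \<Rightarrow> real set" where
  "K m l = {(\<Sum>i. real (d (Suc i)) * l ^ Suc i) | d :: nat \<Rightarrow> nat. \<forall>i\<ge>1. d i \<in> {0..m - 1}}"

definition Lambda :: "nat \<Rightarrow> real \<Rightarrow> real set" where
  "Lambda m x = {l \<in> {0<..1 / real m}. x \<in> K m l}"

definition contains_arbitrarily_long_APs :: "real set \<Rightarrow> bool" where
  "contains_arbitrarily_long_APs E \<longleftrightarrow>
     (\<forall>n :: nat. \<exists>a b :: real. b \<noteq> 0 \<and> (\<lambda>k. a + real k * b) ` {1..n} \<subseteq> E)"

end

theory Submission
  imports Defs
begin

text \<open>
  Write \<open>U = (m - 1) l / (1 - l)\<close> for the largest element of the self-similar set with ratio \<open>l\<close>;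
  it equals 1 at \<open>l = 1 / m\<close>, where the self-similar set is the whole unit interval.  For
  \<open>l < 1 / m\<close> a digit word \<open>w\<close> followed by digit \<open>d\<close> and by \<open>d + 1\<close> leaves a hole in the
  self-similar set.  Both endpoints of the hole increase with \<open>l\<close>, so the parameters for which \<open>x\<close>
  falls into the hole form an open interval \<open>(\<mu>, \<nu>)\<close>, a gap of the set of good parameters,
  and every parameter close to \<open>1 / m\<close> outside all gaps is good
  (\<open>outside_gaps_in_Lambda\<close>).

  Near \<open>1 / m\<close> the gaps are tiny compared with their mutual distances.  The endpoints of the
  digit intervals move with \<open>l\<close> at a speed bounded above and below.  Hence a gap of
  level \<open>i\<close> (the position of the digit \<open>d\<close>) has length at most about \<open>\<nu>^i (1 - U)\<close>
  (\<open>gap_length_le\<close>), while between it and any other gap of level at most \<open>i\<close> there is a bridge, whose length is at least about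
  \<open>\<nu>^i U\<close> (\<open>bridge_above\<close>, \<open>bridge_below\<close>; below the gap, \<open>\<mu>\<close> replaces \<open>\<nu>\<close>).
  Since \<open>U\<close> tends to 1, the distance of two gaps exceeds any prescribed multiple of the length of
  the shorter one, if attention is restricted to a short enough neighbourhood of \<open>1 / m\<close>
  (\<open>gaps_beyond_separated\<close>).

  For such a family, \<open>n\<close> translates can be avoided simultaneously
  (\<open>common_point_of_translates\<close>): keep an interval of length \<open>L\<close> that meets only gaps shorter than
  \<open>L / 3^n\<close>.  By separation, each translate contributes at most one gap of length at least
  \<open>L / 9^n\<close>; remove these \<open>n\<close> gaps one after the other, keeping a third of the interval
  each time, and repeat with \<open>L / 3^n\<close>.  The nested intervals shrink to a point \<open>a\<close> such that
  \<open>a + k b\<close> lies in no gap for \<open>k = 1, \<dots>, n\<close>.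
\<close>

section \<open>Finding a point outside finitely many translates of a family of separated gaps\<close>

text \<open>
  The intervals are removed one at a time: if the current
  interval is at least three times as long as the removed one, its first or its last third survives.
\<close>

lemma subinterval_avoiding_finitely_many:
  fixes l u :: "'k \<Rightarrow> real"
  assumes "finite A" "0 < L"
    and "\<And>k. k \<in> A \<Longrightarrow> u k - l k \<le> L / 3 ^ card A"
  shows "\<exists>t. s \<le> t \<and> t + L / 3 ^ card A \<le> s + L \<and> (\<forall>k\<in>A. u k \<le> t \<or> t + L / 3 ^ card A \<le> l k)"
  using assms
proof (induction A rule: finite_induct)
  case empty
  show ?case by auto
next
  case (insert a A)
  have card: "card (insert a A) = Suc (card A)" using insert by simp
  have le: "L / 3 ^ card A / 3 \<le> L / 3 ^ card A" using insert.prems(1) by (simp add: field_simps)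
  have "u k - l k \<le> L / 3 ^ card A" if "k \<in> A" for k
    using insert.prems(2)[of k] that le unfolding card by (simp add: field_simps)
  then obtain t where t: "s \<le> t" "t + L / 3 ^ card A \<le> s + L"
      "\<forall>k\<in>A. u k \<le> t \<or> t + L / 3 ^ card A \<le> l k"
    using insert.IH insert.prems(1) by blast
  define h where "h = L / 3 ^ Suc (card A)"
  have h: "L / 3 ^ card A = 3 * h" "h > 0" using insert.prems(1) by (simp_all add: h_def)
  have a: "u a - l a \<le> h" using insert.prems(2)[of a] unfolding card h_def by simp
  show ?case
  proof (cases "t + h \<le> l a")
    case True
    then show ?thesis using t h unfolding card h_def[symmetric] by (intro exI[of _ t]) fastforce
  next
    case False
    then show ?thesis using t h a unfolding card h_def[symmetric]
      by (intro exI[of _ "t + 2 * h"]) fastforce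
  qed
qed

text \<open>
  A one-scale form of Newhouse thickness: each gap is given by its pair of endpoints, and \<open>M\<close> bounds
  from below the ratio of the distance of two gaps to the length of the shorter one.
\<close>

definition separated :: "real \<Rightarrow> (real \<times> real) set \<Rightarrow> bool" where
  "separated M G \<longleftrightarrow> (\<forall>l u l' u'. (l, u) \<in> G \<longrightarrow> (l', u') \<in> G \<longrightarrow> (l, u) \<noteq> (l', u') \<longrightarrow> l \<le> l' \<longrightarrow>
     M * min (u - l) (u' - l') \<le> l' - u)"

text \<open>
  Two gaps meeting an interval of length \<open>L\<close> are less than \<open>L\<close> apart; if both had length at least
  \<open>L / M\<close>, separation would put them at distance at least \<open>L\<close>.
\<close>

lemma separated_unique_large:
  assumes "separated M G" "M > 0" "(l, u) \<in> G" "(l', u') \<in> G"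
    and "L / M \<le> u - l" "L / M \<le> u' - l'"
    and "l < s + L" "s < u" "l' < s + L" "s < u'"
  shows "(l, u) = (l', u')"
proof (rule ccontr)
  assume ne: "(l, u) \<noteq> (l', u')"
  have *: "L \<le> M * min (u - l) (u' - l')"
    using assms by (auto simp: min_def field_simps)
  show False
  proof (cases "l \<le> l'")
    case True
    then have "M * min (u - l) (u' - l') \<le> l' - u"
      using assms(1)[unfolded separated_def, rule_format, OF assms(3,4) ne] by simp
    with * show False using assms by linarith
  next
    case False
    then have "M * min (u' - l') (u - l) \<le> l - u'"
      using assms(1)[unfolded separated_def, rule_format, OF assms(4,3) ne[symmetric]] by simp
    with * show False using assms by (simp add: min.commute)
  qed
qed

text \<open>
  The induction step of the nested interval construction.  The gaps of length at least \<open>L / 9 ^ card T\<close>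
  that meet the old interval have to be avoided now; there is at most one for each translate, and
  by the invariant it is short enough for the removal procedure.
\<close>

lemma avoiding_step:
  fixes G :: "(real \<times> real) set" and \<tau> :: "'k \<Rightarrow> real"
  assumes T: "finite T" and sep: "separated (9 ^ card T) G" and L: "L > 0"
    and inv: "\<forall>k\<in>T. \<forall>(l, u)\<in>G. u \<le> s + \<tau> k \<or> s + L + \<tau> k \<le> l \<or> u - l < L / 3 ^ card T"
  obtains t where "s \<le> t" "t + L / 3 ^ card T \<le> s + L"
    "\<forall>k\<in>T. \<forall>(l, u)\<in>G. u \<le> t + \<tau> k \<or> t + L / 3 ^ card T + \<tau> k \<le> l
       \<or> u - l < L / 3 ^ card T / 3 ^ card T"
proof -
  let ?n = "card T"
  have nine: "L / 3 ^ ?n / 3 ^ ?n = L / 9 ^ ?n"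
    by (simp add: power_mult_distrib[symmetric])
  define bad where "bad k l u \<longleftrightarrow>
    (l, u) \<in> G \<and> l < s + L + \<tau> k \<and> s + \<tau> k < u \<and> L / 9 ^ ?n \<le> u - l" for k l u
  have "\<forall>k\<in>T. \<exists>g. snd g - fst g \<le> L / 3 ^ ?n \<and> (\<forall>l u. bad k l u \<longrightarrow> g = (l, u))"
  proof
    fix k assume k: "k \<in> T"
    show "\<exists>g. snd g - fst g \<le> L / 3 ^ ?n \<and> (\<forall>l u. bad k l u \<longrightarrow> g = (l, u))"
    proof (cases "\<exists>l u. bad k l u")
      case True
      then obtain l u where b: "bad k l u" by blast
      have "(l, u) = (l', u')" if "bad k l' u'" for l' u'
        using separated_unique_large[OF sep _, of l u l' u' L "s + \<tau> k"] b that
        unfolding bad_def by (simp add: algebra_simps)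
      moreover have "u - l \<le> L / 3 ^ ?n"
        using inv k b unfolding bad_def by fastforce
      ultimately show ?thesis by (intro exI[of _ "(l, u)"]) auto
    next
      case False
      then show ?thesis using L by (intro exI[of _ "(0, 0)"]) auto
    qed
  qed
  then obtain g where g: "\<And>k. k \<in> T \<Longrightarrow> snd (g k) - fst (g k) \<le> L / 3 ^ ?n"
      "\<And>k l u. k \<in> T \<Longrightarrow> bad k l u \<Longrightarrow> g k = (l, u)"
    using bchoice[of T "\<lambda>k g. snd g - fst g \<le> L / 3 ^ ?n \<and> (\<forall>l u. bad k l u \<longrightarrow> g = (l, u))"]
    by blast
  obtain t where t: "s \<le> t" "t + L / 3 ^ ?n \<le> s + L"
    "\<forall>k\<in>T. snd (g k) - \<tau> k \<le> t \<or> t + L / 3 ^ ?n \<le> fst (g k) - \<tau> k"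
    using subinterval_avoiding_finitely_many[OF T L, of "\<lambda>k. snd (g k) - \<tau> k" "\<lambda>k. fst (g k) - \<tau> k" s] g(1)
    by auto
  have "u \<le> t + \<tau> k \<or> t + L / 3 ^ ?n + \<tau> k \<le> l \<or> u - l < L / 3 ^ ?n / 3 ^ ?n"
    if "k \<in> T" "(l, u) \<in> G" for k l u
  proof (cases "bad k l u")
    case True
    then show ?thesis using t(3) g(2)[OF that(1) True] that by force
  next
    case False
    then show ?thesis using that t(1,2) unfolding bad_def nine by linarith
  qed
  with t(1,2) show ?thesis by (intro that[of t]) auto
qed

lemma common_point_of_translates:
  fixes G :: "(real \<times> real) set" and \<tau> :: "'k \<Rightarrow> real"
  assumes T: "finite T" "T \<noteq> {}" and sep: "separated (9 ^ card T) G" and L: "L > 0"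
    and small: "\<And>l u. (l, u) \<in> G \<Longrightarrow> u - l < L / 3 ^ card T"
  obtains a where "s \<le> a" "a \<le> s + L" "\<forall>k\<in>T. \<forall>(l, u)\<in>G. \<not> (l < a + \<tau> k \<and> a + \<tau> k < u)"
proof -
  let ?n = "card T"
  have n: "?n > 0" using T by (simp add: card_gt_0_iff)
  define Ln where "Ln j = L / (3 ^ ?n) ^ j" for j :: nat
  have Ln_pos: "Ln j > 0" for j using L by (simp add: Ln_def)
  have Ln_Suc: "Ln (Suc j) = Ln j / 3 ^ ?n" for j by (simp add: Ln_def)
  define inv where "inv j t \<longleftrightarrow>
    (\<forall>k\<in>T. \<forall>(l, u)\<in>G. u \<le> t + \<tau> k \<or> t + Ln j + \<tau> k \<le> l \<or> u - l < Ln j / 3 ^ ?n)" for j t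
  have "\<exists>f. \<forall>j. (inv j (f j) \<and> (j = 0 \<longrightarrow> f j = s)) \<and> (f j \<le> f (Suc j) \<and> f (Suc j) + Ln (Suc j) \<le> f j + Ln j)"
  proof (rule dependent_nat_choice)
    have "inv 0 s" using small by (auto simp: inv_def Ln_def)
    then show "\<exists>t. inv 0 t \<and> ((0::nat) = 0 \<longrightarrow> t = s)" by auto
  next
    fix t j
    assume "inv j t \<and> (j = 0 \<longrightarrow> t = s)"
    then have "\<forall>k\<in>T. \<forall>(l, u)\<in>G. u \<le> t + \<tau> k \<or> t + Ln j + \<tau> k \<le> l \<or> u - l < Ln j / 3 ^ ?n"
      by (simp add: inv_def)
    then show "\<exists>t'. (inv (Suc j) t' \<and> (Suc j = 0 \<longrightarrow> t' = s)) \<and> t \<le> t' \<and> t' + Ln (Suc j) \<le> t + Ln j"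
    proof (rule avoiding_step[OF T(1) sep Ln_pos[of j]])
      fix t'
      assume "t \<le> t'" "t' + Ln j / 3 ^ ?n \<le> t + Ln j"
        "\<forall>k\<in>T. \<forall>(l, u)\<in>G. u \<le> t' + \<tau> k \<or> t' + Ln j / 3 ^ ?n + \<tau> k \<le> l
           \<or> u - l < Ln j / 3 ^ ?n / 3 ^ ?n"
      then show ?thesis unfolding inv_def Ln_Suc by blast
    qed
  qed
  then obtain f where "\<forall>j. (inv j (f j) \<and> (j = 0 \<longrightarrow> f j = s)) \<and> (f j \<le> f (Suc j) \<and> f (Suc j) + Ln (Suc j) \<le> f j + Ln j)"
    by (rule exE)
  then have f: "\<And>j. inv j (f j)" "f 0 = s" "\<And>j. f j \<le> f (Suc j)"
      "\<And>j. f (Suc j) + Ln (Suc j) \<le> f j + Ln j"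
    by simp_all
  have mono: "incseq f" using f(3) by (rule incseq_SucI)
  have anti: "decseq (\<lambda>j. f j + Ln j)" using f(4) by (rule decseq_SucI)
  have cross: "f i \<le> f j + Ln j" for i j
    using incseqD[OF mono, of i "max i j"] decseqD[OF anti, of j "max i j"] Ln_pos[of "max i j"] by simp
  define a where "a = (SUP j. f j)"
  have bdd: "bdd_above (range f)" using cross[of _ 0] by (auto intro!: bdd_aboveI)
  have lo: "f j \<le> a" for j unfolding a_def by (rule cSUP_upper[OF _ bdd]) simp
  have hi: "a \<le> f j + Ln j" for j unfolding a_def by (rule cSUP_least) (auto intro: cross)
  have "\<not> (l < a + \<tau> k \<and> a + \<tau> k < u)" if "k \<in> T" "(l, u) \<in> G" for k l u
  proof
    assume inside: "l < a + \<tau> k \<and> a + \<tau> k < u"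
    then have "l < u" by linarith
    have "(\<lambda>j. Ln j) \<longlonglongrightarrow> 0"
      unfolding Ln_def by (rule LIMSEQ_divide_realpow_zero) (use n in simp)
    then have "eventually (\<lambda>j. Ln j < u - l) sequentially"
      using \<open>l < u\<close> by (intro order_tendstoD) auto
    then obtain j where j: "Ln j < u - l" by (auto simp: eventually_sequentially)
    have "Ln j / 3 ^ ?n \<le> Ln j" using Ln_pos[of j] by (simp add: divide_le_eq)
    then have "u \<le> f j + \<tau> k \<or> f j + Ln j + \<tau> k \<le> l"
      using f(1)[of j] that(1,2) j unfolding inv_def by fastforce
    then show False using inside lo[of j] hi[of j] by linarith
  qed
  with lo[of 0] hi[of 0] f(2) show ?thesis by (intro that[of a]) (auto simp: Ln_def)
qed

section \<open>Values of finite digit words\<close>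

text \<open>
  The number \<open>w\<^sub>1 l + \<dots> + w\<^sub>i l\<^sup>i + l\<^sup>i s\<close> with \<open>i = length w\<close>.  The remainder \<open>s\<close> stands for
  the contribution of all later digits: 0 when they vanish, \<open>kmax m l\<close> when they are all maximal.
\<close>

definition val :: "real \<Rightarrow> nat list \<Rightarrow> real \<Rightarrow> real" where
  "val l w s = foldr (\<lambda>d y. l * (real d + y)) w s"

lemma val_simps [simp]:
  "val l [] s = s"
  "val l (d # w) s = l * (real d + val l w s)"
  "val l (w @ w') s = val l w (val l w' s)"
  by (simp_all add: val_def)

lemma val_tail: "val l w s = val l w 0 + l ^ length w * s"
  by (induction w) (simp_all add: algebra_simps)

lemma val_mono: "0 \<le> l \<Longrightarrow> s \<le> s' \<Longrightarrow> val l w s \<le> val l w s'"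
  by (subst val_tail, subst (2) val_tail) (simp add: mult_left_mono)

lemma val_nonneg: "0 \<le> l \<Longrightarrow> 0 \<le> s \<Longrightarrow> 0 \<le> val l w s"
  by (induction w) auto

text \<open>
  The speed bound from below: a value is a power series in \<open>l\<close> with nonnegative coefficients and
  without constant term, so its quotient by \<open>l\<close> is nondecreasing.  The last hypothesis asks the same of the remainder, which
may depend on \<open>l\<close>.
\<close>

lemma val_superlinear:
  assumes "0 < l" "l \<le> l'" "0 \<le> s" "l' * s \<le> l * s'"
  shows "l' * val l w s \<le> l * val l' w s'"
proof (induction w)
  case Nil
  show ?case using assms by simp
next
  case (Cons d w)
  have s': "0 \<le> s'" using assms by (meson mult_nonneg_nonneg order.trans order_less_imp_le zero_le_mult_iff less_le_not_le)
  have "l * val l w s \<le> l' * val l w s"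
    using assms val_nonneg[of l s w] by (intro mult_right_mono) auto
  with Cons.IH have "val l w s \<le> val l' w s'" using assms(1) by (meson mult_le_cancel_left_pos order.trans)
  then have "l' * (l * (real d + val l w s)) \<le> l' * (l * (real d + val l' w s'))"
    using assms by (intro mult_left_mono) auto
  then show ?case by (simp add: ac_simps)
qed

lemma continuous_on_val:
  "continuous_on S s \<Longrightarrow> continuous_on S (\<lambda>l. val l w (s l))"
  by (induction w) (auto intro!: continuous_intros)

definition kmax :: "nat \<Rightarrow> real \<Rightarrow> real" where
  "kmax m l = (real m - 1) * l / (1 - l)"

context
  fixes m :: nat
  assumes m2: "m \<ge> 2"
begin

lemma base_bounds:
  assumes "l \<le> 1 / real m"
  shows "l \<le> 1 / 2" "real m * l \<le> 1"
proof -
  have "1 / real m \<le> 1 / 2" using m2 by (simp add: field_simps)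
  with assms show "l \<le> 1 / 2" by linarith
  show "real m * l \<le> 1" using assms m2 by (simp add: field_simps)
qed

lemma kmax_fixpoint: "l < 1 \<Longrightarrow> l * (real m - 1 + kmax m l) = kmax m l"
  by (simp add: kmax_def field_simps)

lemma one_minus_kmax: "l < 1 \<Longrightarrow> 1 - kmax m l = (1 - real m * l) / (1 - l)"
  by (simp add: kmax_def field_simps)

lemma kmax_bounds:
  assumes "0 < l" "l \<le> 1 / real m"
  shows "0 < kmax m l" "kmax m l \<le> 1"
proof -
  note b = base_bounds[OF assms(2)]
  show "0 < kmax m l" using b assms m2 by (simp add: kmax_def)
  have "0 \<le> 1 - kmax m l" using b one_minus_kmax[of l] by simp
  then show "kmax m l \<le> 1" by simp
qed

lemma kmax_superlinear:
  assumes "0 < l" "l \<le> l'" "l' \<le> 1 / real m"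
  shows "l' * kmax m l \<le> l * kmax m l'"
proof -
  note b = base_bounds[OF assms(3)]
  have "(real m - 1) * l * l' / (1 - l) \<le> (real m - 1) * l * l' / (1 - l')"
    using assms b m2 by (intro divide_left_mono) auto
  then show ?thesis by (simp add: kmax_def ac_simps)
qed

lemma kmax_mono:
  assumes "0 < l" "l \<le> l'" "l' \<le> 1 / real m"
  shows "kmax m l \<le> kmax m l'"
proof -
  have "l * kmax m l \<le> l' * kmax m l"
    using assms kmax_bounds[of l] by (intro mult_right_mono) auto
  then show ?thesis using kmax_superlinear[OF assms] assms(1)
    by (meson mult_le_cancel_left_pos order.trans)
qed

lemma kmax_lipschitz:
  assumes "0 < l" "l \<le> l'" "l' \<le> 1 / real m"
  shows "kmax m l' - kmax m l \<le> 2 * real m * (l' - l)"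
proof -
  note b = base_bounds[OF assms(3)]
  note k = kmax_bounds[of l'] kmax_bounds[of l]
  have "kmax m l' - kmax m l = (l' - l) * (real m - 1 + kmax m l') + l * (kmax m l' - kmax m l)"
    using kmax_fixpoint[of l'] kmax_fixpoint[of l] b assms by (simp add: algebra_simps)
  also have "\<dots> \<le> (l' - l) * real m + 1 / 2 * (kmax m l' - kmax m l)"
    using assms b k kmax_mono[OF assms] by (intro add_mono mult_left_mono mult_right_mono) auto
  finally show ?thesis by (simp add: algebra_simps)
qed

abbreviation word :: "nat list \<Rightarrow> bool" where
  "word w \<equiv> set w \<subseteq> {..<m}"

lemma val_le_kmax:
  assumes "0 < l" "l \<le> 1 / real m" "word w" "s \<le> kmax m l"
  shows "val l w s \<le> kmax m l"
  using assms(3)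
proof (induction w)
  case (Cons d w)
  have "l * (real d + val l w s) \<le> l * (real m - 1 + kmax m l)"
    using Cons assms(1) by (intro mult_left_mono add_mono) auto
  then show ?case using kmax_fixpoint[of l] base_bounds[OF assms(2)] by simp
qed (use assms in auto)

lemma val_bounds:
  assumes "0 < l" "l \<le> 1 / real m" "word w" "0 \<le> s" "s \<le> kmax m l"
  shows "0 \<le> val l w s" "val l w s \<le> kmax m l" "val l w s \<le> 1"
  using val_nonneg[of l s w] val_le_kmax[of l w s] kmax_bounds[of l] assms by auto

text \<open>
  The speed bound from above.  The constant \<open>2 * real m\<close> reproduces itself when a digit is put in front:
  the increment becomes at most \<open>real m + 2\<close> times \<open>l' - l\<close>.
\<close>

lemma val_lipschitz:
  assumes l: "0 < l" "l \<le> l'" "l' \<le> 1 / real m" and w: "word w"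
    and s: "0 \<le> s'" "s' \<le> kmax m l'" "s' - s \<le> 2 * real m * (l' - l)"
  shows "val l' w s' - val l w s \<le> 2 * real m * (l' - l)"
  using w
proof (induction w)
  case (Cons d w)
  note b = base_bounds[of l'] base_bounds[of l]
  let ?V' = "val l' w s'" and ?V = "val l w s"
  have "real d + ?V' \<le> (real m - 1) + 1"
    using Cons.prems l s val_bounds(3)[of l' w s'] by (intro add_mono) auto
  then have "(l' - l) * (real d + ?V') \<le> (l' - l) * real m"
    using l by (intro mult_left_mono) auto
  moreover have "l * (?V' - ?V) \<le> l * (2 * real m * (l' - l))"
    using Cons l by (intro mult_left_mono) auto
  moreover have "l * (2 * real m * (l' - l)) \<le> 2 * (l' - l)"
  proof -
    have "(real m * l) * (2 * (l' - l)) \<le> 1 * (2 * (l' - l))"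
      using b l by (intro mult_right_mono) auto
    then show ?thesis by (simp add: ac_simps)
  qed
  moreover have "2 * (l' - l) \<le> real m * (l' - l)"
    using m2 l by (intro mult_right_mono) auto
  ultimately show ?case by (simp add: algebra_simps)
qed (use s in auto)

text \<open>
  The interval of values with prefix \<open>u\<close> lies on one side of the hole that \<open>v\<close> leaves between
  its continuations by \<open>d\<close> and by \<open>Suc d\<close>.  This is the lexicographic order of digit expansions, which
  values respect as long as \<open>kmax m l \<le> 1\<close>, that is, for \<open>l \<le> 1 / real m\<close>.
\<close>

lemma longer_word_avoids_gap:
  assumes l: "0 < l" "l \<le> 1 / real m" and "word v" "word u" "Suc d < m" "length v < length u"
  shows "val l u (kmax m l) \<le> val l (v @ [d]) (kmax m l) \<or> val l (v @ [Suc d]) 0 \<le> val l u 0"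
  using assms(3-)
proof (induction v arbitrary: u)
  case Nil
  then obtain e u' where u: "u = e # u'" by (cases u) auto
  have b: "val l u' (kmax m l) \<le> kmax m l" "0 \<le> val l u' 0"
    using val_bounds[OF l, of u'] Nil u kmax_bounds[OF l] by auto
  show ?case
  proof (cases "e \<le> d")
    case True
    then have "l * (real e + val l u' (kmax m l)) \<le> l * (real d + kmax m l)"
      using b l by (intro mult_left_mono add_mono) auto
    then show ?thesis using u by simp
  next
    case False
    then have "l * (real (Suc d) + 0) \<le> l * (real e + val l u' 0)"
      using b l by (intro mult_left_mono add_mono) auto
    then show ?thesis using u by simp
  qed
next
  case (Cons c v)
  then obtain e u' where u: "u = e # u'" by (cases u) auto
  have k: "0 < kmax m l" "kmax m l \<le> 1" using kmax_bounds[OF l] by auto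
  have b: "val l u' (kmax m l) \<le> kmax m l" "0 \<le> val l u' 0"
    using val_bounds[OF l, of u'] Cons.prems u k by auto
  have v: "0 \<le> val l (v @ [d]) (kmax m l)" "val l (v @ [Suc d]) 0 \<le> kmax m l"
    using val_bounds[OF l, of "v @ [d]" "kmax m l"] val_bounds[OF l, of "v @ [Suc d]" 0] Cons.prems k by auto
  consider "e = c" | "Suc e \<le> c" | "Suc c \<le> e" by linarith
  then show ?case
  proof cases
    case 1
    have "val l u' (kmax m l) \<le> val l (v @ [d]) (kmax m l) \<or> val l (v @ [Suc d]) 0 \<le> val l u' 0"
      using Cons.prems u by (intro Cons.IH) auto
    then show ?thesis using l 1 u by auto
  next
    case 2
    then have "real e + val l u' (kmax m l) \<le> real c + val l (v @ [d]) (kmax m l)"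
      using b v k by linarith
    then show ?thesis using l u by (auto simp del: val_simps(3))
  next
    case 3
    then have "real c + val l (v @ [Suc d]) 0 \<le> real e + val l u' 0"
      using b v k by linarith
    then show ?thesis using l u by (auto simp del: val_simps(3))
  qed
qed

text \<open>
  A hole determines its word and digit: words of different lengths are excluded because all values
  with the longer word as a prefix lie on one side of the hole of the shorter one, and words of equal
  length are compared digit by digit.
\<close>

lemma gap_word_unique:
  assumes l: "0 < l" "l \<le> 1 / real m"
    and "word v" "Suc d < m" "val l (v @ [d]) (kmax m l) < y" "y < val l (v @ [Suc d]) 0"
    and "word v'" "Suc d' < m" "val l (v' @ [d']) (kmax m l) < y" "y < val l (v' @ [Suc d']) 0"
  shows "v = v' \<and> d = d'"
proof -
  have k: "0 < kmax m l" "kmax m l \<le> 1" using kmax_bounds[OF l] by auto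
  have A: "length v' \<le> length v"
    if "word v" "Suc d < m" "val l (v @ [d]) (kmax m l) < y" "y < val l (v @ [Suc d]) 0"
      "word v'" "Suc d' < m" "val l (v' @ [d']) (kmax m l) < y" "y < val l (v' @ [Suc d']) 0" for v d v' d'
  proof (rule ccontr)
    assume "\<not> ?thesis"
    then have "val l v' (kmax m l) \<le> val l (v @ [d]) (kmax m l) \<or> val l (v @ [Suc d]) 0 \<le> val l v' 0"
      using that by (intro longer_word_avoids_gap[OF l]) auto
    moreover have "val l (v' @ [Suc d']) 0 \<le> val l v' (kmax m l)"
      using val_le_kmax[OF l, of "[Suc d']" 0] that l k by (auto intro!: val_mono)
    moreover have "val l v' 0 \<le> val l (v' @ [d']) (kmax m l)"
      using l k by (auto intro!: val_mono)
    ultimately show False using that by linarith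
  qed
  have len: "length v = length v'" using A[OF assms(3-10)] A[OF assms(7-10) assms(3-6)] by simp
  then show ?thesis using assms(3-)
  proof (induction v v' arbitrary: y rule: list_induct2)
    case Nil
    have "l * real d < l * real (Suc d')" "l * real d' < l * real (Suc d)"
      using Nil l k mult_pos_pos[OF l(1) k(1)] by (auto simp: algebra_simps)
    then show ?case using l by auto
  next
    case (Cons c v c' v')
    have b: "0 \<le> val l (w @ [e]) (kmax m l)" "val l (w @ [Suc e]) 0 \<le> 1" if "word w" "Suc e < m" for w e
      using val_bounds[OF l, of "w @ [e]" "kmax m l"] val_bounds[OF l, of "w @ [Suc e]" 0] k that by auto
    have lt: "real c < real (Suc c')" if "word v" "Suc d < m" "word v'" "Suc d' < m"
        "l * (real c + val l (v @ [d]) (kmax m l)) < y" "y < l * (real c' + val l (v' @ [Suc d']) 0)"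
      for c c' v d v' d'
    proof -
      have "l * (real c + val l (v @ [d]) (kmax m l)) < l * (real c' + val l (v' @ [Suc d']) 0)"
        using that by linarith
      then have "real c + val l (v @ [d]) (kmax m l) < real c' + val l (v' @ [Suc d']) 0" using l by simp
      then show ?thesis using b[of v d] b[of v' d'] that by simp
    qed
    have "c = c'"
      using lt[of v d v' d' c c'] lt[of v' d' v d c' c] Cons.prems by simp
    moreover have "v = v' \<and> d = d'"
    proof (rule Cons.IH)
      show "val l (v @ [d]) (kmax m l) < y / l - real c" "y / l - real c < val l (v @ [Suc d]) 0"
        "val l (v' @ [d']) (kmax m l) < y / l - real c" "y / l - real c < val l (v' @ [Suc d']) 0"
        using Cons.prems \<open>c = c'\<close> l by (auto simp: field_simps)
    qed (use Cons.prems in auto)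
    ultimately show ?case by simp
  qed
qed

lemma left_end_mono:
  assumes "0 < l" "l < l'" "l' \<le> 1 / real m"
  shows "val l w 0 \<le> val l' w 0" "0 < val l w 0 \<Longrightarrow> val l w 0 < val l' w 0"
proof -
  have *: "l' * val l w 0 \<le> l * val l' w 0" using assms by (intro val_superlinear) auto
  have 0: "0 \<le> val l w 0" using assms by (intro val_nonneg) auto
  then have "l * val l w 0 \<le> l' * val l w 0" using assms by (intro mult_right_mono) auto
  with * show "val l w 0 \<le> val l' w 0" using assms by (meson mult_le_cancel_left_pos order.trans)
  assume "0 < val l w 0"
  then have "l * val l w 0 < l' * val l w 0" using assms by simp
  with * have "l * val l w 0 < l * val l' w 0" by linarith
  then show "val l w 0 < val l' w 0" using assms by simp
qed

lemma right_end_strict_mono: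
  assumes "0 < l" "l < l'" "l' \<le> 1 / real m"
  shows "val l w (kmax m l) < val l' w (kmax m l')"
proof -
  have k: "0 < kmax m l" using kmax_bounds[of l] assms by auto
  have *: "l' * val l w (kmax m l) \<le> l * val l' w (kmax m l')"
    using assms k kmax_superlinear[of l l'] by (intro val_superlinear) auto
  have "0 < val l w (kmax m l)"
    using val_tail[of l w "kmax m l"] val_nonneg[of l 0 w] k assms by (simp add: add_nonneg_pos)
  then have "l * val l w (kmax m l) < l' * val l w (kmax m l)" using assms by simp
  with * have "l * val l w (kmax m l) < l * val l' w (kmax m l')" by linarith
  then show ?thesis using assms by simp
qed

lemma gap_width:
  "val l (w @ [Suc d]) 0 - val l (w @ [d]) (kmax m l) = l ^ Suc (length w) * (1 - kmax m l)"
  using val_tail[of l "w" "l * (1 + real d)"] val_tail[of l "w" "l * (real d + kmax m l)"]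
  by (simp add: algebra_simps)

section \<open>The gaps of the parameter set\<close>

context
  fixes x :: real
  assumes x: "0 < x" "x < 1"
begin

text \<open>
  The gap of \<open>w\<close> and \<open>d\<close>, described by its endpoints: at the lower one, \<open>x\<close> is the upper end
  of the hole between the continuations by \<open>d\<close> and \<open>Suc d\<close>, at the upper one it is the lower end.
\<close>

definition is_gap :: "nat list \<Rightarrow> nat \<Rightarrow> real \<Rightarrow> real \<Rightarrow> bool" where
  "is_gap w d \<mu> \<nu> \<longleftrightarrow> word w \<and> Suc d < m \<and> 0 < \<mu> \<and> \<mu> < \<nu> \<and> \<nu> \<le> 1 / real m \<and>
     val \<mu> (w @ [Suc d]) 0 = x \<and> val \<nu> (w @ [d]) (kmax m \<nu>) = x"

text \<open>
  At an endpoint of the gap, \<open>x\<close> is one end of the hole.  The other end has distance from \<open>x\<close> equal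
  to the width of the hole, and this distance is covered, at a speed bounded below, on the way to the
  other endpoint of the gap.  Both forms are needed, because \<open>\<mu>\<close> and \<open>\<nu>\<close> raised to a high power are
  not comparable: the bridge above the gap is measured at \<open>\<nu>\<close>, the one below at \<open>\<mu>\<close>.
\<close>

lemma gap_length_le:
  assumes "is_gap w d \<mu> \<nu>"
  shows "(\<nu> - \<mu>) * (real m * x) \<le> \<nu> ^ Suc (length w) * (1 - kmax m \<nu>)"
    and "(\<nu> - \<mu>) * (real m * x) \<le> \<mu> ^ Suc (length w) * (1 - kmax m \<mu>)"
proof -
  note g = assms[unfolded is_gap_def]
  note b = base_bounds[of \<mu>] base_bounds[of \<nu>]
  have scale: "(\<nu> - \<mu>) * (real m * x) \<le> y" if "(\<nu> - \<mu>) * x \<le> z * y" "0 < z" "real m * z \<le> 1" for y z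
  proof -
    have "z * y \<ge> 0" using that g x by (meson diff_ge_0_iff_ge less_imp_le mult_nonneg_nonneg order.trans)
    then have y: "y \<ge> 0" using that(2) by (simp add: zero_le_mult_iff)
    have "real m * ((\<nu> - \<mu>) * x) \<le> real m * (z * y)" using that by (intro mult_left_mono) auto
    also have "\<dots> = (real m * z) * y" by simp
    also have "\<dots> \<le> 1 * y" using that y by (intro mult_right_mono) auto
    finally show ?thesis by (simp add: algebra_simps)
  qed
  have "\<nu> * val \<mu> (w @ [Suc d]) 0 \<le> \<mu> * val \<nu> (w @ [Suc d]) 0"
    using g by (intro val_superlinear) auto
  then have "(\<nu> - \<mu>) * x \<le> \<mu> * (val \<nu> (w @ [Suc d]) 0 - val \<nu> (w @ [d]) (kmax m \<nu>))"
    using g by (simp add: algebra_simps del: val_simps)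
  then show "(\<nu> - \<mu>) * (real m * x) \<le> \<nu> ^ Suc (length w) * (1 - kmax m \<nu>)"
    unfolding gap_width using g b by (intro scale[of \<mu>]) auto
  have "\<nu> * val \<mu> (w @ [d]) (kmax m \<mu>) \<le> \<mu> * val \<nu> (w @ [d]) (kmax m \<nu>)"
    using g kmax_superlinear[of \<mu> \<nu>] kmax_bounds[of \<mu>] by (intro val_superlinear) auto
  then have "(\<nu> - \<mu>) * x \<le> \<nu> * (val \<mu> (w @ [Suc d]) 0 - val \<mu> (w @ [d]) (kmax m \<mu>))"
    using g by (simp add: algebra_simps del: val_simps)
  then show "(\<nu> - \<mu>) * (real m * x) \<le> \<mu> ^ Suc (length w) * (1 - kmax m \<mu>)"
    unfolding gap_width using g b by (intro scale[of \<nu>]) auto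
qed

text \<open>
  At \<open>1 / real m\<close> the hole has width 0, so a gap ending there would have length 0.
\<close>

lemma gap_bounded_away:
  assumes "is_gap w d \<mu> \<nu>"
  shows "\<nu> < 1 / real m"
proof (rule ccontr)
  note g = assms[unfolded is_gap_def]
  assume "\<not> ?thesis"
  then have \<nu>: "\<nu> = 1 / real m" using g by simp
  have "1 - kmax m \<nu> = 0" using \<nu> m2 one_minus_kmax[of \<nu>] by simp
  then have "(\<nu> - \<mu>) * (real m * x) \<le> 0" using gap_length_le(1)[OF assms] by simp
  moreover have "(\<nu> - \<mu>) * (real m * x) > 0" using g x m2 by simp
  ultimately show False by simp
qed

lemma gap_interior:
  assumes "is_gap w d \<mu> \<nu>" "\<mu> < l" "l < \<nu>"
  shows "val l (w @ [d]) (kmax m l) < x" "x < val l (w @ [Suc d]) 0"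
  using right_end_strict_mono[of l \<nu> "w @ [d]"] left_end_mono(2)[of \<mu> l "w @ [Suc d]"] assms x
  unfolding is_gap_def by (auto simp del: val_simps)

text \<open>
  Between \<open>\<nu>\<close> and \<open>\<mu>'\<close> the point \<open>x\<close> has to cross the whole interval of values with prefix \<open>w @ [d]\<close>:
  it is the largest of them at \<open>\<nu>\<close>, and it cannot lie inside that interval at \<open>\<mu>'\<close>, where it is an
  end of a hole of lower or equal level.
\<close>

lemma bridge_above:
  assumes g: "is_gap w d \<mu> \<nu>" and g': "is_gap w' d' \<mu>' \<nu>'"
    and len: "length w' \<le> length w" and le: "\<nu> \<le> \<mu>'"
  shows "\<nu> ^ Suc (length w) * kmax m \<nu> \<le> 2 * real m * (\<mu>' - \<nu>)"
proof -
  note G = g[unfolded is_gap_def] and G' = g'[unfolded is_gap_def]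
  have "val \<mu>' (w @ [d]) (kmax m \<mu>') \<le> val \<mu>' (w' @ [d']) (kmax m \<mu>') \<or>
      val \<mu>' (w' @ [Suc d']) 0 \<le> val \<mu>' (w @ [d]) 0"
    using G G' len by (intro longer_word_avoids_gap) auto
  moreover have "val \<mu>' (w' @ [d']) (kmax m \<mu>') < x"
    using right_end_strict_mono[of \<mu>' \<nu>' "w' @ [d']"] G' by simp
  moreover have "x \<le> val \<mu>' (w @ [d]) (kmax m \<mu>')"
    using right_end_strict_mono[of \<nu> \<mu>' "w @ [d]"] G G' le by (cases "\<nu> = \<mu>'") auto
  ultimately have "x \<le> val \<mu>' (w @ [d]) 0" using G' by linarith
  moreover have "val \<mu>' (w @ [d]) 0 - val \<nu> (w @ [d]) 0 \<le> 2 * real m * (\<mu>' - \<nu>)"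
    using G G' le kmax_bounds[of \<mu>'] by (intro val_lipschitz) auto
  moreover have "x - val \<nu> (w @ [d]) 0 = \<nu> ^ Suc (length w) * kmax m \<nu>"
    using G val_tail[of \<nu> "w @ [d]" "kmax m \<nu>"] by (simp del: val_simps)
  ultimately show ?thesis by linarith
qed

text \<open>
  The mirror image of \<open>bridge_above\<close>, with the interval of values with prefix \<open>w @ [Suc d]\<close>.
\<close>

lemma bridge_below:
  assumes g: "is_gap w d \<mu> \<nu>" and g': "is_gap w' d' \<mu>' \<nu>'"
    and len: "length w' \<le> length w" and le: "\<nu>' \<le> \<mu>"
  shows "\<mu> ^ Suc (length w) * kmax m \<mu> \<le> 2 * real m * (\<mu> - \<nu>')"
proof -
  note G = g[unfolded is_gap_def] and G' = g'[unfolded is_gap_def]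
  let ?u = "w @ [Suc d]"
  have "val \<nu>' ?u (kmax m \<nu>') \<le> val \<nu>' (w' @ [d']) (kmax m \<nu>') \<or>
      val \<nu>' (w' @ [Suc d']) 0 \<le> val \<nu>' ?u 0"
    using G G' len by (intro longer_word_avoids_gap) auto
  moreover have "x < val \<nu>' (w' @ [Suc d']) 0"
    using left_end_mono(2)[of \<mu>' \<nu>' "w' @ [Suc d']"] G' x by (simp del: val_simps)
  moreover have "val \<nu>' ?u 0 \<le> x"
    using left_end_mono(1)[of \<nu>' \<mu> ?u] G G' le by (cases "\<nu>' = \<mu>") auto
  ultimately have "val \<nu>' ?u (kmax m \<nu>') \<le> x" using G' by linarith
  moreover have "val \<mu> ?u (kmax m \<mu>) - val \<nu>' ?u (kmax m \<nu>') \<le> 2 * real m * (\<mu> - \<nu>')"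
    using G G' le kmax_bounds[of \<mu>] kmax_lipschitz[of \<nu>' \<mu>] by (intro val_lipschitz) auto
  moreover have "val \<mu> ?u (kmax m \<mu>) - x = \<mu> ^ Suc (length w) * kmax m \<mu>"
    using G val_tail[of \<mu> ?u "kmax m \<mu>"] by (simp del: val_simps)
  ultimately show ?thesis by linarith
qed

lemma gaps_disjoint:
  assumes g: "is_gap w d \<mu> \<nu>" and g': "is_gap w' d' \<mu>' \<nu>'" and ne: "(\<mu>, \<nu>) \<noteq> (\<mu>', \<nu>')"
  shows "\<nu> \<le> \<mu>' \<or> \<nu>' \<le> \<mu>"
proof (rule ccontr)
  assume meet: "\<not> ?thesis"
  note G = g[unfolded is_gap_def] and G' = g'[unfolded is_gap_def]
  obtain l where l: "max \<mu> \<mu>' < l" "l < min \<nu> \<nu>'"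
    using dense[of "max \<mu> \<mu>'" "min \<nu> \<nu>'"] meet G G' by auto
  have eq: "w = w' \<and> d = d'"
    using gap_word_unique[of l w d x w' d'] gap_interior[OF g, of l] gap_interior[OF g', of l] l G G' by auto
  have "\<mu> = \<mu>'"
    using left_end_mono(2)[of \<mu> \<mu>' "w @ [Suc d]"] left_end_mono(2)[of \<mu>' \<mu> "w @ [Suc d]"] G G' eq x
    by (cases \<mu> \<mu>' rule: linorder_cases) (auto simp del: val_simps)
  moreover have "\<nu> = \<nu>'"
    using right_end_strict_mono[of \<nu> \<nu>' "w @ [d]"] right_end_strict_mono[of \<nu>' \<nu> "w @ [d]"] G G' eq
    by (cases \<nu> \<nu>' rule: linorder_cases) (auto simp del: val_simps)
  ultimately show False using ne by simp
qed

text \<open>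
  A gap of length \<open>D\<close> and an adjacent bridge of length \<open>B\<close>, both measured at the common endpoint
  \<open>l\<close>: the factors \<open>l ^ i\<close> cancel, and \<open>(1 - kmax m l) / kmax m l\<close> decreases in \<open>l\<close>.
\<close>

lemma bridge_gap_ratio:
  assumes p: "0 < p" "p \<le> l" "l \<le> 1 / real m" and M: "2 * M * (1 - kmax m p) \<le> x * kmax m p" "0 \<le> M"
    and gap: "D * (real m * x) \<le> l ^ i * (1 - kmax m l)"
    and bridge: "l ^ i * kmax m l \<le> 2 * real m * B"
  shows "M * D \<le> B"
proof -
  have k: "kmax m p \<le> kmax m l" using p by (intro kmax_mono)
  have "2 * M * (1 - kmax m l) \<le> 2 * M * (1 - kmax m p)" using k M by (intro mult_left_mono) auto
  also have "\<dots> \<le> x * kmax m p" by (rule M)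
  also have "\<dots> \<le> x * kmax m l" using k x by (intro mult_left_mono) auto
  finally have r: "2 * M * (1 - kmax m l) \<le> x * kmax m l" .
  have "2 * M * (D * (real m * x)) \<le> 2 * M * (l ^ i * (1 - kmax m l))"
    using gap M by (intro mult_left_mono) auto
  also have "\<dots> = l ^ i * (2 * M * (1 - kmax m l))" by simp
  also have "\<dots> \<le> l ^ i * (x * kmax m l)" using r p by (intro mult_left_mono) auto
  also have "\<dots> = x * (l ^ i * kmax m l)" by simp
  also have "\<dots> \<le> x * (2 * real m * B)" using bridge x by (intro mult_left_mono) auto
  finally have "(2 * real m * x) * (M * D) \<le> (2 * real m * x) * B" by (simp add: algebra_simps)
  then show ?thesis using m2 x by (subst (asm) mult_le_cancel_left_pos) auto
qed

text \<open>
  Only the upper endpoint is required to lie beyond \<open>p\<close>, so that a gap straddling \<open>p\<close> is included.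
  Separation survives: no other gap of the family lies below a straddling one, and
  the bridge above it is measured at its upper endpoint.
\<close>

definition gaps_beyond :: "real \<Rightarrow> (real \<times> real) set" where
  "gaps_beyond p = {(\<mu>, \<nu>). p < \<nu> \<and> (\<exists>w d. is_gap w d \<mu> \<nu>)}"

text \<open>
  Between two gaps there is a bridge belonging to the one with the longer word; its
  length is at least the minimum of the two, so comparing the bridge with this gap suffices.
\<close>

lemma gaps_beyond_separated:
  assumes p: "0 < p" and M: "2 * M * (1 - kmax m p) \<le> x * kmax m p" "0 \<le> M"
  shows "separated M (gaps_beyond p)"
proof -
  have "M * min (\<nu> - \<mu>) (\<nu>' - \<mu>') \<le> \<mu>' - \<nu>"
    if g: "is_gap w d \<mu> \<nu>" and g': "is_gap w' d' \<mu>' \<nu>'" and lt: "p < \<nu>" "p < \<nu>'"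
      and ne: "(\<mu>, \<nu>) \<noteq> (\<mu>', \<nu>')" and le: "\<mu> \<le> \<mu>'" for w d \<mu> \<nu> w' d' \<mu>' \<nu>'
  proof -
    note G = g[unfolded is_gap_def] and G' = g'[unfolded is_gap_def]
    have ord: "\<nu> \<le> \<mu>'" using gaps_disjoint[OF g g' ne] le G' by linarith
    show ?thesis
    proof (cases "length w' \<le> length w")
      case True
      have "M * (\<nu> - \<mu>) \<le> \<mu>' - \<nu>"
        by (rule bridge_gap_ratio[OF p _ _ M gap_length_le(1)[OF g] bridge_above[OF g g' True ord]])
           (use lt G in auto)
      moreover have "M * min (\<nu> - \<mu>) (\<nu>' - \<mu>') \<le> M * (\<nu> - \<mu>)" using M by (intro mult_left_mono) auto
      ultimately show ?thesis by linarith
    next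
      case False
      then have len: "length w \<le> length w'" by simp
      have "M * (\<nu>' - \<mu>') \<le> \<mu>' - \<nu>"
        by (rule bridge_gap_ratio[OF p _ _ M gap_length_le(2)[OF g'] bridge_below[OF g' g len ord]])
           (use lt ord G' in auto)
      moreover have "M * min (\<nu> - \<mu>) (\<nu>' - \<mu>') \<le> M * (\<nu>' - \<mu>')" using M by (intro mult_left_mono) auto
      ultimately show ?thesis by linarith
    qed
  qed
  then show ?thesis unfolding separated_def gaps_beyond_def by blast
qed

section \<open>Parameters outside all gaps\<close>

text \<open>
  The endpoints come from the intermediate value theorem.  Downwards, the upper end of the hole
  decreases to 0; upwards, the lower end of the hole is at least \<open>x\<close> at \<open>1 / real m\<close>, where both ends
  coincide.
\<close>

lemma gap_around:
  assumes l: "0 < l" "l \<le> 1 / real m" and w: "word w" "Suc d < m"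
    and lt: "val l (w @ [d]) (kmax m l) < x" "x < val l (w @ [Suc d]) 0"
  obtains \<mu> \<nu> where "is_gap w d \<mu> \<nu>" "\<mu> < l" "l < \<nu>"
proof -
  let ?A = "\<lambda>l. val l (w @ [Suc d]) 0" and ?U = "\<lambda>l. val l (w @ [d]) (kmax m l)"
  have "?A 0 = 0" by (induction w) auto
  then have "\<exists>\<mu>\<ge>0. \<mu> \<le> l \<and> ?A \<mu> = x"
    using l lt x by (intro IVT' continuous_on_val continuous_on_const) auto
  then obtain \<mu> where \<mu>: "0 \<le> \<mu>" "\<mu> \<le> l" "?A \<mu> = x" by blast
  have \<mu>': "0 < \<mu>" "\<mu> < l" using \<mu> \<open>?A 0 = 0\<close> lt x by (auto simp: less_le simp del: val_simps)
  have k1: "kmax m (1 / real m) = 1" using one_minus_kmax[of "1 / real m"] m2 by simp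
  have top: "?U (1 / real m) = ?A (1 / real m)" using gap_width[of "1 / real m" w d] k1 by simp
  have "x \<le> ?U (1 / real m)"
    unfolding top using left_end_mono(1)[of l "1 / real m" "w @ [Suc d]"] l lt by (cases "l = 1 / real m") auto
  moreover have "continuous_on {l..1 / real m} ?U"
  proof (rule continuous_on_val)
    have "l' \<noteq> 1" if "l' \<le> 1 / real m" for l' using base_bounds[OF that] by auto
    then show "continuous_on {l..1 / real m} (kmax m)"
      unfolding kmax_def by (auto intro!: continuous_intros)
  qed
  ultimately have "\<exists>\<nu>\<ge>l. \<nu> \<le> 1 / real m \<and> ?U \<nu> = x"
    using l lt by (intro IVT') auto
  then obtain \<nu> where \<nu>: "l \<le> \<nu>" "\<nu> \<le> 1 / real m" "?U \<nu> = x" by blast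
  have "l < \<nu>" using \<nu> lt by (auto simp: less_le simp del: val_simps)
  with \<mu> \<mu>' \<nu> w show ?thesis by (intro that[of \<mu> \<nu>]) (auto simp: is_gap_def)
qed

lemma next_digit:
  assumes l: "0 < l" "l \<le> 1 / real m" and y: "0 \<le> y" "y \<le> kmax m l"
  shows "(\<exists>d y'. d < m \<and> 0 \<le> y' \<and> y' \<le> kmax m l \<and> y = l * (real d + y'))
    \<or> (\<exists>d. Suc d < m \<and> l * (real d + kmax m l) < y \<and> y < l * real (Suc d))"
proof -
  define d where "d = min (nat \<lfloor>y / l\<rfloor>) (m - 1)"
  have yl: "0 \<le> y / l" using l y by simp
  have d: "d < m" "real d \<le> y / l" using m2 yl by (auto simp: d_def min_def) linarith+
  show ?thesis
  proof (cases "y / l - real d \<le> kmax m l")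
    case True
    then show ?thesis using d l by (intro disjI1 exI[of _ d] exI[of _ "y / l - real d"]) auto
  next
    case False
    have ge: "l * (real d + kmax m l) < y" using False l by (simp add: field_simps)
    have "d \<noteq> m - 1"
    proof
      assume "d = m - 1"
      then have "real d = real m - 1" using m2 by auto
      then show False using ge y kmax_fixpoint[of l] base_bounds[OF l(2)] by simp
    qed
    then have "d = nat \<lfloor>y / l\<rfloor>" "Suc d < m" using d by (auto simp: d_def)
    then have "y / l < real (Suc d)" using yl by linarith
    then have "y < l * real (Suc d)" using l by (simp add: field_simps)
    with ge \<open>Suc d < m\<close> show ?thesis by blast
  qed
qed

text \<open>
  Digits are chosen one by one, keeping the remainder between 0 and \<open>kmax m l\<close>.  A failure of this
  choice means that \<open>x\<close> lies in a hole, so that \<open>l\<close> lies in a gap.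
\<close>

lemma outside_gaps_in_Lambda:
  assumes l: "0 < l" "l \<le> 1 / real m" and xk: "x \<le> kmax m l"
    and out: "\<And>w d \<mu> \<nu>. is_gap w d \<mu> \<nu> \<Longrightarrow> \<not> (\<mu> < l \<and> l < \<nu>)"
  shows "l \<in> Lambda m x"
proof -
  define ok where "ok i p \<longleftrightarrow> length (fst p) = i \<and> word (fst p) \<and> 0 \<le> snd p \<and> snd p \<le> kmax m l \<and>
    x = val l (fst p) (snd p)" for i :: nat and p
  have "\<exists>f. \<forall>i. ok i (f i) \<and> (\<exists>d<m. fst (f (Suc i)) = fst (f i) @ [d])"
  proof (rule dependent_nat_choice)
    show "\<exists>p. ok 0 p" using x xk by (intro exI[of _ "([], x)"]) (simp add: ok_def)
  next
    fix p :: "nat list \<times> real" and i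
    assume ok: "ok i p"
    obtain w y where p: "p = (w, y)" by (cases p)
    have wy: "length w = i" "word w" "0 \<le> y" "y \<le> kmax m l" "x = val l w y"
      using ok p by (auto simp: ok_def)
    from next_digit[OF l wy(3,4)] show "\<exists>p'. ok (Suc i) p' \<and> (\<exists>d<m. fst p' = fst p @ [d])"
    proof (elim disjE exE conjE)
      fix d y' assume "d < m" "0 \<le> y'" "y' \<le> kmax m l" "y = l * (real d + y')"
      then show ?thesis using wy p by (intro exI[of _ "(w @ [d], y')"]) (auto simp: ok_def)
    next
      fix d assume d: "Suc d < m" "l * (real d + kmax m l) < y" "y < l * real (Suc d)"
      have less: "val l w s < val l w s'" if "s < s'" for s s'
        using that l by (subst val_tail, subst (2) val_tail) simp
      have "val l (w @ [d]) (kmax m l) < x" "x < val l (w @ [Suc d]) 0"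
        using wy(5) less[OF d(2)] less[OF d(3)] by simp_all
      then obtain \<mu> \<nu> where "is_gap w d \<mu> \<nu>" "\<mu> < l" "l < \<nu>"
        using gap_around[OF l wy(2) d(1)] by blast
      with out show ?thesis by blast
    qed
  qed
  then obtain f where f: "\<And>i. ok i (f i)" "\<And>i. \<exists>d<m. fst (f (Suc i)) = fst (f i) @ [d]" by blast
  obtain e where e: "\<And>i. e i < m" "\<And>i. fst (f (Suc i)) = fst (f i) @ [e i]" using f(2) by metis
  have partial: "val l (fst (f i)) s = (\<Sum>j<i. real (e j) * l ^ Suc j) + l ^ i * s" for i s
  proof (induction i arbitrary: s)
    case 0
    then show ?case using f(1)[of 0] by (simp add: ok_def)
  next
    case (Suc i)
    then show ?case by (simp add: e(2) algebra_simps)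
  qed
  have "(\<lambda>i. real (e i) * l ^ Suc i) sums x"
  proof -
    have l1: "l < 1" using base_bounds[OF l(2)] by simp
    have "(\<lambda>i. l ^ i * snd (f i)) \<longlonglongrightarrow> 0"
    proof (rule tendsto_sandwich[where f = "\<lambda>_. 0" and h = "\<lambda>i. l ^ i * kmax m l"])
      show "(\<lambda>i. l ^ i * kmax m l) \<longlonglongrightarrow> 0"
        using l l1 by (intro tendsto_mult_left_zero LIMSEQ_power_zero) auto
      show "(\<lambda>i. 0 :: real) \<longlonglongrightarrow> 0" by simp
      show "eventually (\<lambda>i. 0 \<le> l ^ i * snd (f i)) sequentially"
        using f(1) l by (intro always_eventually) (auto simp: ok_def)
      show "eventually (\<lambda>i. l ^ i * snd (f i) \<le> l ^ i * kmax m l) sequentially"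
        using f(1) l by (intro always_eventually) (auto simp: ok_def intro!: mult_left_mono)
    qed
    then have "(\<lambda>i. x - l ^ i * snd (f i)) \<longlonglongrightarrow> x - 0" by (intro tendsto_intros)
    moreover have "x - l ^ i * snd (f i) = (\<Sum>j<i. real (e j) * l ^ Suc j)" for i
      using f(1)[of i] partial[of i "snd (f i)"] by (simp add: ok_def)
    ultimately show ?thesis unfolding sums_def by simp
  qed
  then have "x = (\<Sum>i. real (e (Suc i - 1)) * l ^ Suc i)" by (simp add: sums_iff)
  moreover have "e i \<in> {0..m - 1}" for i using e(1)[of i] by auto
  ultimately have "x \<in> K m l"
    unfolding K_def by (intro CollectI exI[of _ "\<lambda>i. e (i - 1)"] conjI allI impI)
  then show ?thesis using l by (simp add: Lambda_def)
qed

section \<open>Choosing a neighbourhood of the largest parameter\<close>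

text \<open>
  There are finitely many words of bounded length, each gap is determined by its word and digit, and
  none of them reaches \<open>1 / real m\<close>.
\<close>

lemma eventually_no_gap_of_short_word:
  "eventually (\<lambda>p. \<forall>w d \<mu> \<nu>. is_gap w d \<mu> \<nu> \<and> length w \<le> i \<longrightarrow> \<nu> < p) (at_left (1 / real m))"
proof -
  let ?W = "{w. word w \<and> length w \<le> i} \<times> {..<m}"
  have fin: "finite ?W" using finite_lists_length_le[of "{..<m}" i] by auto
  have ev: "eventually (\<lambda>p. \<forall>\<mu> \<nu>. is_gap w d \<mu> \<nu> \<longrightarrow> \<nu> < p) (at_left (1 / real m))" for w d
  proof (cases "\<exists>\<mu> \<nu>. is_gap w d \<mu> \<nu>")
    case True
    then obtain \<mu> \<nu> where g: "is_gap w d \<mu> \<nu>" by blast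
    have same: "\<nu>' = \<nu>" if "is_gap w d \<mu>' \<nu>'" for \<mu>' \<nu>'
      using right_end_strict_mono[of \<nu> \<nu>' "w @ [d]"] right_end_strict_mono[of \<nu>' \<nu> "w @ [d]"] g that
      by (cases \<nu> \<nu>' rule: linorder_cases) (auto simp: is_gap_def simp del: val_simps)
    have "eventually (\<lambda>p. \<nu> < p) (at_left (1 / real m))"
      using eventually_at_left_real[OF gap_bounded_away[OF g]] by (auto elim: eventually_mono)
    then show ?thesis by eventually_elim (use same in blast)
  next
    case False
    then show ?thesis by auto
  qed
  have "eventually (\<lambda>p. \<forall>a\<in>?W. \<forall>\<mu> \<nu>. is_gap (fst a) (snd a) \<mu> \<nu> \<longrightarrow> \<nu> < p) (at_left (1 / real m))"
    using fin ev by (intro eventually_ball_finite) auto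
  then show ?thesis
  proof eventually_elim
    case (elim p)
    have "\<nu> < p" if g: "is_gap w d \<mu> \<nu>" and "length w \<le> i" for w d \<mu> \<nu>
    proof -
      have "(w, d) \<in> ?W" using that by (simp add: is_gap_def)
      with elim have "\<forall>\<mu> \<nu>. is_gap w d \<mu> \<nu> \<longrightarrow> \<nu> < p" by (metis fst_conv snd_conv)
      with g show ?thesis by blast
    qed
    then show ?case by blast
  qed
qed

text \<open>
  The interval between \<open>p\<close> and \<open>1 / real m\<close> is split into halves of length \<open>L\<close>: the point \<open>a\<close> is
  searched for in the lower half, and the step \<open>L / real n\<close> keeps the progression below \<open>1 / real m\<close>.
  The gaps beyond \<open>p\<close> are short compared with \<open>L\<close> because \<open>1 - kmax m \<nu>\<close> is at most \<open>4 * real m * L\<close>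
  and the words have length above \<open>i\<close>, which is chosen before \<open>p\<close>.
\<close>

lemma arithmetic_progression_in_Lambda:
  assumes n: "n > 0"
  shows "\<exists>a b. b \<noteq> 0 \<and> (\<lambda>k. a + real k * b) ` {1..n} \<subseteq> Lambda m x"
proof -
  obtain i where i: "(1 / 2) ^ i < x / (4 * 3 ^ n)"
    using real_arch_pow_inv[of "x / (4 * 3 ^ n)" "1 / 2"] x by auto
  have m0: "0 < 1 / real m" "1 / real m < 1" using m2 by auto
  have "isCont (kmax m) (1 / real m)"
    unfolding kmax_def using m2 by (intro continuous_intros) auto
  then have "(kmax m \<longlongrightarrow> kmax m (1 / real m)) (at_left (1 / real m))"
    unfolding isCont_def by (rule tendsto_mono[rotated]) (simp add: at_le)
  moreover have "kmax m (1 / real m) = 1" using one_minus_kmax[of "1 / real m"] m2 by simp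
  ultimately have k: "(kmax m \<longlongrightarrow> 1) (at_left (1 / real m))" by simp
  have e1: "eventually (\<lambda>p. x < kmax m p) (at_left (1 / real m))"
    using k x by (intro order_tendstoD) auto
  have "((\<lambda>p. x * kmax m p - 2 * 9 ^ n * (1 - kmax m p)) \<longlongrightarrow> x * 1 - 2 * 9 ^ n * (1 - 1)) (at_left (1 / real m))"
    by (intro tendsto_intros k)
  then have e2: "eventually (\<lambda>p. 0 < x * kmax m p - 2 * 9 ^ n * (1 - kmax m p)) (at_left (1 / real m))"
    using x by (intro order_tendstoD) auto
  have e3: "eventually (\<lambda>p. 0 < p \<and> p < 1 / real m) (at_left (1 / real m))"
    using eventually_at_left_real[OF m0(1)] by (auto elim: eventually_mono)
  have "eventually (\<lambda>p. x < kmax m p \<and> 2 * 9 ^ n * (1 - kmax m p) \<le> x * kmax m p \<and> 0 < p \<and> p < 1 / real m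
      \<and> (\<forall>w d \<mu> \<nu>. is_gap w d \<mu> \<nu> \<and> length w \<le> i \<longrightarrow> \<nu> < p)) (at_left (1 / real m))"
    using e1 e2 e3 eventually_no_gap_of_short_word[of i] by eventually_elim auto
  then obtain p where p: "x < kmax m p" "2 * 9 ^ n * (1 - kmax m p) \<le> x * kmax m p" "0 < p" "p < 1 / real m"
      "\<And>w d \<mu> \<nu>. is_gap w d \<mu> \<nu> \<Longrightarrow> length w \<le> i \<Longrightarrow> \<nu> < p"
    using eventually_happens[of _ "at_left (1 / real m)"] trivial_limit_at_left_real by blast
  define L where "L = (1 / real m - p) / 2"
  define b where "b = L / real n"
  have L: "L > 0" "p + 2 * L = 1 / real m" using p by (auto simp: L_def field_simps)
  have b: "b > 0" using L n by (simp add: b_def)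
  let ?G = "gaps_beyond p"
  have small: "\<nu> - \<mu> < L / 3 ^ n" if gap: "(\<mu>, \<nu>) \<in> ?G" for \<mu> \<nu>
  proof -
    obtain w d where g: "is_gap w d \<mu> \<nu>" "p < \<nu>" using gap by (auto simp: gaps_beyond_def)
    have \<nu>: "0 < \<nu>" "\<nu> \<le> 1 / real m" using g p by (auto simp: is_gap_def)
    note bb = base_bounds[OF \<nu>(2)]
    have len: "i \<le> Suc (length w)" using p(5)[OF g(1)] g(2) by linarith
    have "\<nu> ^ Suc (length w) \<le> (1 / 2) ^ Suc (length w)" using bb \<nu> by (intro power_mono) auto
    also have "\<dots> \<le> (1 / 2) ^ i" using len by (intro power_decreasing) auto
    finally have pw: "\<nu> ^ Suc (length w) \<le> (1 / 2) ^ i" .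
    have "1 - kmax m \<nu> = (1 - real m * \<nu>) / (1 - \<nu>)" using bb by (intro one_minus_kmax) auto
    also have "\<dots> \<le> (1 - real m * \<nu>) / (1 / 2)" using bb by (intro divide_left_mono) auto
    also have "\<dots> \<le> 2 * (1 - real m * p)" using g(2) m2 by simp
    also have "\<dots> = 4 * real m * L" using m2 by (simp add: L_def field_simps)
    finally have kk: "1 - kmax m \<nu> \<le> 4 * real m * L" .
    have "(\<nu> - \<mu>) * (real m * x) \<le> \<nu> ^ Suc (length w) * (1 - kmax m \<nu>)" by (rule gap_length_le(1)[OF g(1)])
    also have "\<dots> \<le> (1 / 2) ^ i * (4 * real m * L)"
      using pw kk kmax_bounds[OF \<nu>] by (intro mult_mono) auto
    also have "\<dots> < x / (4 * 3 ^ n) * (4 * real m * L)" using i L m2 by (intro mult_strict_right_mono) auto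
    also have "\<dots> = (L / 3 ^ n) * (real m * x)" by simp
    finally show ?thesis using m2 x by (subst (asm) mult_less_cancel_right_pos) auto
  qed
  have sep: "separated (9 ^ card {1..n}) ?G"
    using gaps_beyond_separated[OF p(3), of "9 ^ n"] p(2) by simp
  obtain a where a: "p \<le> a" "a \<le> p + L"
      "\<forall>k\<in>{1..n}. \<forall>(l, u)\<in>?G. \<not> (l < a + real k * b \<and> a + real k * b < u)"
    using common_point_of_translates[OF _ _ sep L(1), of p "\<lambda>k. real k * b"] small n by auto
  have "a + real k * b \<in> Lambda m x" if k: "k \<in> {1..n}" for k
  proof (rule outside_gaps_in_Lambda)
    have "real k * b \<le> real n * b" using k b by (intro mult_right_mono) auto
    also have "\<dots> = L" using n by (simp add: b_def)
    finally have kb: "0 \<le> real k * b" "real k * b \<le> L" using b by auto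
    show pos: "0 < a + real k * b" and le: "a + real k * b \<le> 1 / real m" using kb a L p by auto
    show "x \<le> kmax m (a + real k * b)"
      using kmax_mono[OF p(3) _ le] p(1) a(1) kb by linarith
    fix w d \<mu> \<nu> assume g: "is_gap w d \<mu> \<nu>"
    show "\<not> (\<mu> < a + real k * b \<and> a + real k * b < \<nu>)"
    proof
      assume in_gap: "\<mu> < a + real k * b \<and> a + real k * b < \<nu>"
      then have "(\<mu>, \<nu>) \<in> ?G" using g a(1) kb by (auto simp: gaps_beyond_def)
      then show False using a(3) k in_gap by fastforce
    qed
  qed
  then show ?thesis using b by (intro exI[of _ a] exI[of _ b]) auto
qed

end

end

theorem mainTheorem7:
  fixes m :: nat and x :: real
  assumes "m \<ge> 2" and "x \<in> {0<..<1}"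
  shows "contains_arbitrarily_long_APs (Lambda m x)"
  unfolding contains_arbitrarily_long_APs_def
proof
  fix n :: nat
  show "\<exists>a b. b \<noteq> 0 \<and> (\<lambda>k. a + real k * b) ` {1..n} \<subseteq> Lambda m x"
  proof (cases "n = 0")
    case True
    then show ?thesis by (intro exI[of _ 0] exI[of _ 1]) simp
  next
    case False
    then show ?thesis using arithmetic_progression_in_Lambda[of m x n] assms by simp
  qed
qed

end
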